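(* Let $f\in\mathbb{F}_2[x]$ be a nonzero polynomial with $x(x+1)\mid f$, and let $D=\{f_1,f_2,\ldots,f_k\}$ ($k\ge 1$) be a set of divisors of $f$ with $f\notin D$. Let $\overline{D}=\{\gcd(f_i,x(x+1)) : 1\le i\le k\}$. Then the gcd-graph $G_f(D)$ is connected if and only if both of the following hold: (1) $\gcd(f_1,f_2,\ldots,f_k)=1$; and (2) the graph $G_{x(x+1)}(\overline{D})$ is connected. Moreover, condition (2) is equivalent to $|\overline{D}\setminus\{x(x+1)\}|\ge 2$.
   Context: For a nonzero $f\in\mathbb{F}_2[x]$ and a set $D$ of divisors of $f$, the gcd-graph $G_f(D)$ is the undirected graph with vertex set the ring $\mathbb{F}_2[x]/(f)$ in which two vertices $u,v$ are adjacent if and only if $\gcd(u-v,f)\in D$ (with $\gcd(0,f)=f$). If $f\notin D$ the graph is loopless. The set $\overline{D}$ may contain $x(x+1)$, in which case $G_{x(x+1)}(\overline{D})$ formally has loops; these are irrelevant for connectedness. *)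

theory Defs
  imports
    "HOL-Library.Z2"
    "HOL-Computational_Algebra.Computational_Algebra"
    "HOL-Computational_Algebra.Field_as_Ring"
    "Graph_Theory.Digraph_Component"
begin

text \<open>
  The field $F_2$ is the type \<^typ>\<open>bit\<close>. The library gives it a field structure but not the
  trivial Euclidean structure of a field, without which \<^typ>\<open>bit poly\<close> has no \<^const>\<open>gcd\<close>;
  the instances below are those that the library declares for \<^typ>\<open>real\<close> and \<^typ>\<open>rat\<close>.
\<close>

instantiation bit ::
  "{unique_euclidean_ring, normalization_euclidean_semiring, normalization_semidom_multiplicative}"
begin

definition [simp]: "normalize_bit = (normalize_field :: bit \<Rightarrow> _)"
definition [simp]: "unit_factor_bit = (unit_factor_field :: bit \<Rightarrow> _)"
definition [simp]: "euclidean_size_bit = (euclidean_size_field :: bit \<Rightarrow> _)"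
definition [simp]: "division_segment (x :: bit) = 1"

instance
proof
  fix a b c :: bit
  show "a \<noteq> 0 \<Longrightarrow> is_unit (unit_factor a)"
    by (cases a) simp_all
  show "is_unit a \<Longrightarrow> unit_factor (a * b) = a * unit_factor b"
    by (cases a) simp_all
  show "b \<noteq> 0 \<Longrightarrow> euclidean_size (a mod b) < euclidean_size b"
    by (cases a; cases b) simp_all
  show "b \<noteq> 0 \<Longrightarrow> euclidean_size a \<le> euclidean_size (a * b)"
    by (cases a; cases b) simp_all
  show "is_unit (division_segment a)"
    by simp
  show "a \<noteq> 0 \<Longrightarrow> b \<noteq> 0 \<Longrightarrow> division_segment (a * b) = division_segment a * division_segment b"
    by simp
qed (auto split: if_splits)

end

instantiation bit :: euclidean_ring_gcd
begin

definition gcd_bit :: "bit \<Rightarrow> bit \<Rightarrow> bit" where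
  "gcd_bit = Euclidean_Algorithm.gcd"
definition lcm_bit :: "bit \<Rightarrow> bit \<Rightarrow> bit" where
  "lcm_bit = Euclidean_Algorithm.lcm"
definition Gcd_bit :: "bit set \<Rightarrow> bit" where
  "Gcd_bit = Euclidean_Algorithm.Gcd"
definition Lcm_bit :: "bit set \<Rightarrow> bit" where
  "Lcm_bit = Euclidean_Algorithm.Lcm"

instance
  by standard (simp_all add: gcd_bit_def lcm_bit_def Gcd_bit_def Lcm_bit_def)

end

instance bit :: field_gcd ..

abbreviation pX :: "bit poly" where
  "pX \<equiv> [:0, 1:]"

text \<open>The only unit of $F_2[x]$ is $1$, so greatest common divisors are literally unique.\<close>

lemma normalize_bit_poly [simp]: "normalize p = (p :: bit poly)"
proof (cases "p = 0")
  case False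
  then have "lead_coeff p = 1"
    by (metis bit_not_zero_iff leading_coeff_0_iff)
  then show ?thesis
    by (simp add: normalize_poly_def one_pCons [symmetric])
qed simp

lemma gcd_0_bit_poly: "gcd 0 f = (f :: bit poly)"
  by simp

definition residue_rel :: "bit poly \<Rightarrow> (bit poly \<times> bit poly) set" where
  "residue_rel f = {(u, v). f dvd u - v}"

lemma equiv_residue_rel: "equiv UNIV (residue_rel f)"
proof (rule equivI)
  show "sym (residue_rel f)"
    unfolding residue_rel_def sym_def by (auto simp: dvd_diff_commute)
  show "trans (residue_rel f)"
  proof (rule transI)
    fix u v w
    assume "(u, v) \<in> residue_rel f" "(v, w) \<in> residue_rel f"
    then have "f dvd (u - v) + (v - w)"
      unfolding residue_rel_def by (intro dvd_add) auto
    then show "(u, w) \<in> residue_rel f"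
      by (simp add: residue_rel_def)
  qed
qed (simp_all add: residue_rel_def refl_on_def)

text \<open>
  Vertices are the elements of $F_2[x]/(f)$, as residue classes. Representatives enter the
  adjacency relation only through \<^term>\<open>gcd (u - v) f\<close>, which does not depend on their choice
  (see \<open>gcd_graph_arc_iff\<close>). An undirected edge is a pair of opposite arcs; loops are
  arcs \<^term>\<open>(U, U)\<close>.
\<close>

definition gcd_graph :: "bit poly \<Rightarrow> bit poly set \<Rightarrow> bit poly set pair_pre_digraph" where
  "gcd_graph f D =
    \<lparr> pverts = UNIV // residue_rel f,
      parcs = {(U, V). U \<in> UNIV // residue_rel f \<and> V \<in> UNIV // residue_rel f \<and>
                       (\<exists>u\<in>U. \<exists>v\<in>V. gcd (u - v) f \<in> D)} \<rparr>"

lemma gcd_graph_arc_iff: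
  "(residue_rel f `` {u}, residue_rel f `` {v}) \<in> parcs (gcd_graph f D) \<longleftrightarrow> gcd (u - v) f \<in> D"
proof -
  have indep: "gcd (u' - v') f = gcd (u - v) f"
    if "f dvd u - u'" "f dvd v - v'" for u' v'
  proof -
    have "f dvd (u - u') - (v - v')"
      using that by (rule dvd_diff)
    also have "(u - u') - (v - v') = (u - v) - (u' - v')"
      by simp
    finally have "(u - v) mod f = (u' - v') mod f"
      by (simp only: mod_eq_dvd_iff)
    then have "gcd ((u - v) mod f) f = gcd ((u' - v') mod f) f"
      by (rule arg_cong)
    then show ?thesis
      by (cases "f = 0") simp_all
  qed
  have vert: "residue_rel f `` {w} \<in> UNIV // residue_rel f" for w
    by (simp add: quotientI)
  have self: "w \<in> residue_rel f `` {w}" for w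
    by (simp add: residue_rel_def)
  show ?thesis
  proof
    assume "(residue_rel f `` {u}, residue_rel f `` {v}) \<in> parcs (gcd_graph f D)"
    then obtain u' v' where "f dvd u - u'" "f dvd v - v'" "gcd (u' - v') f \<in> D"
      by (auto simp: gcd_graph_def residue_rel_def)
    then show "gcd (u - v) f \<in> D"
      by (simp only: indep)
  next
    assume "gcd (u - v) f \<in> D"
    then have "\<exists>u'\<in>residue_rel f `` {u}. \<exists>v'\<in>residue_rel f `` {v}. gcd (u' - v') f \<in> D"
      using self by blast
    then show "(residue_rel f `` {u}, residue_rel f `` {v}) \<in> parcs (gcd_graph f D)"
      using vert by (simp add: gcd_graph_def)
  qed
qed

lemma gcd_graph_symmetric: "symmetric (with_proj (gcd_graph f D))"
proof -
  have comm: "gcd (v - u) f = gcd (u - v) f" for u v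
    using gcd_neg1[of "u - v" f] by (simp only: minus_diff_eq)
  have "(V, U) \<in> parcs (gcd_graph f D)" if "(U, V) \<in> parcs (gcd_graph f D)" for U V
    using that unfolding gcd_graph_def by (simp add: Bex_def) (metis comm)
  then show ?thesis
    by (simp add: symmetric_def sym_def)
qed

lemma gcd_graph_loopless:
  assumes "f \<notin> D"
  shows "(U, U) \<notin> parcs (gcd_graph f D)"
proof
  assume loop: "(U, U) \<in> parcs (gcd_graph f D)"
  then obtain u where "U = residue_rel f `` {u}"
    by (auto simp: gcd_graph_def elim: quotientE)
  with loop have "gcd (u - u) f \<in> D"
    by (simp only: gcd_graph_arc_iff)
  with assms show False
    by simp
qed

end

theory Submission
  imports Defs
begin

text \<open>
  Two vertices of \<open>G_f(D)\<close> are adjacent when their difference lies in the set \<open>S\<close> of all \<open>s\<close> with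
  \<open>gcd(s, f) \<in> D\<close>, so the graph is a Cayley graph of an additive group, and it is connected if and
  only if the additive subgroup \<open>H\<close> generated by \<open>S\<close> is the whole polynomial ring
  (\<open>connected_iff_span\<close>). The question is therefore when \<open>H\<close> is everything.

  Write \<open>M = x(x+1)\<close>. Since \<open>S\<close> is stable under multiplication by polynomials coprime to \<open>f\<close>, so is
  \<open>H\<close>, and \<open>H\<close> is then also stable under multiplication by sums of such polynomials. The point is
  that every multiple of \<open>M\<close> is a sum of two polynomials coprime to \<open>f\<close>
  (\<open>pM_multiple_sum_of_two_coprime\<close>): a prime of degree at least 2 has a residue field with more than
  two elements, so it leaves room to write any residue as a sum of two nonzero ones, while for the
  two linear primes the only nonzero residue is 1, and \<open>1 + 1 = 0\<close> is just what a multiple of \<open>M\<close>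
  requires. Hence \<open>H\<close> contains \<open>M I\<close>, where \<open>I\<close> is the ideal generated by \<open>D\<close>. If \<open>gcd(D) = 1\<close>, then
  \<open>H\<close> contains every multiple of \<open>M\<close>, and whether \<open>H\<close> is everything depends only on the image of
  \<open>S\<close> modulo \<open>M\<close>, that is, on the graph of \<open>M\<close> and \<open>Dbar\<close> (\<open>span_UNIV_iff\<close>). The converse holds
  because \<open>gcd(D)\<close> divides every element of \<open>H\<close>.

  Finally, the residue ring modulo \<open>M\<close> is \<open>F_2 \<times> F_2\<close>, through evaluation at 0 and 1. Its only unit
  is 1, so there a residue is determined by its gcd with \<open>M\<close>. The additive group has order 4; two
  distinct nonzero elements generate it and fewer do not (\<open>span_pM_iff\<close>).
\<close>

section \<open>Additive subgroups of the polynomial ring\<close>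

text \<open>
  In characteristic 2 every element is its own negative, so closure under sums already gives the
  subgroup generated by the set.
\<close>

inductive_set additive_span :: "bit poly set \<Rightarrow> bit poly set" for S :: "bit poly set" where
  zero: "0 \<in> additive_span S"
| step: "s \<in> S \<Longrightarrow> h \<in> additive_span S \<Longrightarrow> s + h \<in> additive_span S"

lemma bit_poly_two_eq_zero [simp]: "(2 :: bit poly) = 0"
  by (simp add: numeral_poly)

lemma bit_poly_add_self [simp]: "p + p = (0 :: bit poly)"
  by (simp flip: mult_2)

lemma bit_poly_uminus [simp]: "- p = (p :: bit poly)"
  by (rule minus_unique) simp

lemma additive_span_base: "s \<in> S \<Longrightarrow> s \<in> additive_span S"
  using additive_span.step[OF _ additive_span.zero, of s S] by simp

lemma additive_span_add:
  assumes "a \<in> additive_span S" "b \<in> additive_span S"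
  shows "a + b \<in> additive_span S"
  using assms by induction (auto simp: add.assoc intro: additive_span.step)

lemma additive_span_minimal:
  assumes "S \<subseteq> H" "0 \<in> H" "\<And>a b. a \<in> H \<Longrightarrow> b \<in> H \<Longrightarrow> a + b \<in> H"
  shows "additive_span S \<subseteq> H"
proof
  fix h
  assume "h \<in> additive_span S"
  then show "h \<in> H"
    by induction (use assms in auto)
qed

lemma additive_span_subset:
  assumes "S \<subseteq> additive_span T"
  shows "additive_span S \<subseteq> additive_span T"
  using assms by (intro additive_span_minimal additive_span.zero additive_span_add)

section \<open>The connection set and connectedness\<close>

definition gcd_connection_set :: "bit poly \<Rightarrow> bit poly set \<Rightarrow> bit poly set" where
  "gcd_connection_set f D = {s. gcd s f \<in> D}"

text \<open>
  The span is a union of residue classes modulo \<open>f\<close>, which allows vertices to be replaced by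
  representatives: for \<open>d \<in> D\<close> and a multiple \<open>p\<close> of \<open>f\<close>, both \<open>d\<close> and \<open>p + d\<close> are connecting, and
  their sum is \<open>p\<close>.
\<close>

lemma dvd_imp_mem_span:
  assumes "d \<in> D" "d dvd f" "f dvd p"
  shows "p \<in> additive_span (gcd_connection_set f D)"
proof -
  have d: "gcd d f = d"
    using assms(2) by (simp add: gcd_proj1_if_dvd)
  obtain c where p: "p = c * f"
    using assms(3) by (metis dvd_def mult.commute)
  have "gcd (p + d) f = gcd d f"
    using gcd_add_mult[of f c d] by (simp add: p gcd.commute)
  then have "p + d \<in> gcd_connection_set f D" "d \<in> gcd_connection_set f D"
    using d assms(1) by (simp_all add: gcd_connection_set_def)
  then have "(p + d) + d \<in> additive_span (gcd_connection_set f D)"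
    by (intro additive_span_add additive_span_base)
  then show ?thesis
    by (simp add: add.assoc)
qed

lemma class_eqI: "(u, v) \<in> residue_rel f \<Longrightarrow> residue_rel f `` {u} = residue_rel f `` {v}"
  by (rule equiv_class_eq[OF equiv_residue_rel])

text \<open>
  A walk is a sequence of partial sums of connecting elements: the vertices that can be reached from
  \<open>u\<close> are the classes of \<open>h + u\<close> with \<open>h\<close> in the span.
\<close>

lemma connected_iff_span:
  assumes "D \<noteq> {}" "\<forall>d\<in>D. d dvd f"
  shows "Digraph_Component.connected (with_proj (gcd_graph f D)) \<longleftrightarrow>
         additive_span (gcd_connection_set f D) = UNIV"
proof -
  define G where "G = with_proj (gcd_graph f D)"
  let ?cl = "\<lambda>u. residue_rel f `` {u}"
  let ?H = "additive_span (gcd_connection_set f D)"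
  have wf: "wf_digraph G"
    by standard (auto simp: G_def gcd_graph_def)
  have verts: "verts G = range ?cl"
    by (auto simp: G_def gcd_graph_def quotient_def)
  have adj: "?cl u \<rightarrow>\<^bsub>G\<^esub> ?cl v \<longleftrightarrow> u - v \<in> gcd_connection_set f D" for u v
    by (simp add: G_def gcd_graph_arc_iff gcd_connection_set_def)
  have conn: "Digraph_Component.connected G \<longleftrightarrow> (\<forall>u v. ?cl u \<rightarrow>\<^sup>*\<^bsub>G\<^esub> ?cl v)"
    unfolding Digraph_Component.connected_def strongly_connected_def
    by (simp add: wf_digraph.reachable_mk_symmetric_eq[OF wf]
        gcd_graph_symmetric[of f D, folded G_def] verts)
  have reach: "?cl u \<rightarrow>\<^sup>*\<^bsub>G\<^esub> ?cl (h + u)" if "h \<in> ?H" for h u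
    using that
  proof induction
    case zero
    then show ?case
      using wf verts by (simp add: wf_digraph.reachable_refl)
  next
    case (step s h)
    have "?cl (h + u) \<rightarrow>\<^bsub>G\<^esub> ?cl (s + h + u)"
      unfolding adj using step.hyps by (simp add: gcd_connection_set_def)
    with step.IH show ?case
      by (rule wf_digraph.reachable_adj_trans[OF wf])
  qed
  have span: "v \<in> ?H" if "?cl 0 \<rightarrow>\<^sup>*\<^bsub>G\<^esub> V" "v \<in> V" for v V
    using that
  proof (induction arbitrary: v rule: wf_digraph.reachable_induct[OF wf, consumes 1])
    case 1
    obtain d where "d \<in> D" "d dvd f"
      using assms by blast
    moreover have "f dvd v"
      using 1 by (simp add: residue_rel_def)
    ultimately show ?case
      by (rule dvd_imp_mem_span)
  next
    case (2 V W)
    then obtain w where W: "W = ?cl w" and V: "V \<in> verts G"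
      using wf_digraph.adj_in_verts[OF wf, of V W] verts by auto
    then obtain u where V: "V = ?cl u"
      using verts by auto
    have "u \<in> V"
      by (simp add: V residue_rel_def)
    then have u: "u \<in> ?H"
      by (rule "2.IH")
    have "W = ?cl v"
      using 2 unfolding W by (intro class_eqI) simp
    then have "u - v \<in> gcd_connection_set f D"
      using "2.hyps" by (simp add: V adj)
    then have "(u - v) + u \<in> ?H"
      using u by (rule additive_span.step)
    then show ?case
      by simp
  qed
  show ?thesis
    unfolding G_def[symmetric] conn
  proof
    assume "\<forall>u v. ?cl u \<rightarrow>\<^sup>*\<^bsub>G\<^esub> ?cl v"
    moreover have "v \<in> ?cl v" for v
      by (simp add: residue_rel_def)
    ultimately have "v \<in> ?H" for v
      using span by blast
    then show "?H = UNIV"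
      by blast
  next
    assume H: "?H = UNIV"
    show "\<forall>u v. ?cl u \<rightarrow>\<^sup>*\<^bsub>G\<^esub> ?cl v"
    proof (intro allI)
      fix u v
      have "v - u \<in> ?H"
        using H by simp
      from reach[OF this, of u] show "?cl u \<rightarrow>\<^sup>*\<^bsub>G\<^esub> ?cl v"
        by simp
    qed
  qed
qed

section \<open>Residues modulo $x(x+1)$\<close>

abbreviation pM :: "bit poly" where
  "pM \<equiv> pX * (pX + 1)"

lemma pX_dvd_iff: "pX dvd p \<longleftrightarrow> poly p 0 = 0" for p :: "bit poly"
  by (simp add: poly_eq_0_iff_dvd)

lemma pX1_dvd_iff: "pX + 1 dvd p \<longleftrightarrow> poly p 1 = 0" for p :: "bit poly"
  by (simp add: poly_eq_0_iff_dvd one_pCons)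

lemma pM_dvd_iff: "pM dvd p \<longleftrightarrow> poly p 0 = 0 \<and> poly p 1 = 0" for p :: "bit poly"
proof -
  have "coprime pX (pX + 1)"
    by simp
  then show ?thesis
    unfolding pX_dvd_iff[symmetric] pX1_dvd_iff[symmetric]
    by (meson divides_mult dvd_mult_left dvd_mult_right)
qed

lemma pM_dvd_diff_iff:
  "pM dvd p - q \<longleftrightarrow> poly p 0 = poly q 0 \<and> poly p 1 = poly q 1" for p q :: "bit poly"
  unfolding pM_dvd_iff poly_diff by (metis eq_iff_diff_eq_0)

text \<open>
  Modulo \<open>x(x+1)\<close> there are four residues and four possible greatest common divisors, and the two
  determine each other.
\<close>

lemma gcd_pM_eq_iff: "gcd p pM = gcd q pM \<longleftrightarrow> pM dvd p - q" for p q :: "bit poly"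
proof
  assume eq: "gcd p pM = gcd q pM"
  have dvd: "r dvd p \<longleftrightarrow> r dvd q" if "r dvd pM" for r
    using eq that by (metis gcd_greatest_iff)
  have "pX dvd p \<longleftrightarrow> pX dvd q" "pX + 1 dvd p \<longleftrightarrow> pX + 1 dvd q"
    by (rule dvd; simp only: dvd_triv_left dvd_triv_right)+
  then show "pM dvd p - q"
    unfolding pM_dvd_diff_iff pX_dvd_iff pX1_dvd_iff
    by (cases "poly p 0"; cases "poly p 1") auto
next
  assume "pM dvd p - q"
  then have "p mod pM = q mod pM"
    by (simp only: mod_eq_dvd_iff)
  moreover have "pM \<noteq> 0"
    by (simp add: one_pCons)
  ultimately show "gcd p pM = gcd q pM"
    by (metis gcd_mod_left)
qed

text \<open>
  The span is the preimage of a subgroup of the Klein four-group, whose nonzero generators are the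
  images of the elements of \<open>E\<close> other than \<open>x(x+1)\<close> itself.
\<close>

lemma span_pM_iff:
  assumes E: "E \<noteq> {}" "\<forall>e\<in>E. e dvd pM"
  shows "additive_span (gcd_connection_set pM E) = UNIV \<longleftrightarrow> card (E - {pM}) \<ge> 2"
proof -
  let ?H = "additive_span (gcd_connection_set pM E)"
  have gcd_E: "gcd e pM = e" if "e \<in> E" for e
    using E that by (simp add: gcd_proj1_if_dvd del: mult_pCons_left)
  have E_eq: "e = e'" if "e \<in> E" "e' \<in> E" "pM dvd e - e'" for e e'
    using that gcd_E gcd_pM_eq_iff by metis
  have E_pM: "e = pM" if "e \<in> E" "pM dvd e" for e
    using that gcd_E gcd_proj2_if_dvd normalize_bit_poly by metis
  have "inj_on (\<lambda>e. (poly e 0, poly e 1)) E"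
    by (rule inj_onI) (auto intro!: E_eq simp only: pM_dvd_diff_iff prod.inject)
  moreover have "finite (UNIV :: bit set)"
    by (rule finite_subset[of _ "{0, 1}"]) (auto intro: bit.exhaust)
  ultimately have fin: "finite E"
    by (meson finite_imageD finite_Prod_UNIV finite_subset subset_UNIV)
  have card: "card (E - {pM}) \<ge> 2 \<longleftrightarrow> (\<exists>a\<in>E - {pM}. \<exists>b\<in>E - {pM}. a \<noteq> b)"
    using fin card_le_Suc0_iff_eq[of "E - {pM}"] by (auto simp del: mult_pCons_left)
  show ?thesis
    unfolding card
  proof
    assume H: "?H = UNIV"
    show "\<exists>a\<in>E - {pM}. \<exists>b\<in>E - {pM}. a \<noteq> b"
    proof (rule ccontr)
      assume "\<not> ?thesis"
      then obtain e where e: "E - {pM} \<subseteq> {e}"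
        by blast
      \<comment> \<open>The generators then lie in the preimage of a subgroup of order at most 2,
        which misses one of the residues of \<open>1\<close> and \<open>x\<close>.\<close>
      let ?L = "{s. pM dvd s \<or> pM dvd s - e}"
      have "?H \<subseteq> ?L"
      proof (rule additive_span_minimal)
        show "gcd_connection_set pM E \<subseteq> ?L"
        proof
          fix s
          assume "s \<in> gcd_connection_set pM E"
          then have s: "gcd s pM \<in> E"
            by (simp only: gcd_connection_set_def mem_Collect_eq)
          have "gcd (gcd s pM) pM = gcd s pM"
            by (simp only: gcd_proj1_if_dvd gcd_dvd2 normalize_bit_poly)
          then have "pM dvd gcd s pM - s"
            by (simp only: gcd_pM_eq_iff)
          moreover have "gcd s pM = pM \<or> gcd s pM = e"
            using s e by blast
          ultimately have "pM dvd s \<or> pM dvd e - s"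
            by (metis gcd_dvd1)
          then show "s \<in> ?L"
            by (simp only: mem_Collect_eq dvd_diff_commute)
        qed
      next
        show "a + b \<in> ?L" if "a \<in> ?L" "b \<in> ?L" for a b
          using that unfolding mem_Collect_eq pM_dvd_diff_iff pM_dvd_iff poly_add
          by (elim disjE conjE; simp)
      qed simp
      then have "1 \<in> ?L" "pX \<in> ?L"
        using H by auto
      then show False
        by (simp only: mem_Collect_eq pM_dvd_diff_iff pM_dvd_iff) auto
    qed
  next
    assume "\<exists>a\<in>E - {pM}. \<exists>b\<in>E - {pM}. a \<noteq> b"
    then obtain a b where ab: "a \<in> E" "b \<in> E" "\<not> pM dvd a" "\<not> pM dvd b" "\<not> pM dvd a - b"
      using E_pM E_eq by blast
    have ab_H: "a \<in> ?H" "b \<in> ?H"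
      using ab gcd_E by (auto intro!: additive_span_base simp only: gcd_connection_set_def mem_Collect_eq)
    have trans: "p \<in> ?H" if "pM dvd p - h" "h \<in> ?H" for p h
    proof -
      have "p - h \<in> ?H"
        using dvd_imp_mem_span ab(1) E(2) that(1) by blast
      then have "(p - h) + h \<in> ?H"
        using that(2) by (rule additive_span_add)
      then show ?thesis
        by simp
    qed
    have "p \<in> ?H" for p
    proof -
      have "pM dvd p - 0 \<or> pM dvd p - a \<or> pM dvd p - b \<or> pM dvd p - (a + b)"
        using ab(3-5) unfolding pM_dvd_diff_iff pM_dvd_iff poly_add poly_0
        by (cases "poly p 0"; cases "poly p 1"; cases "poly a 0"; cases "poly a 1";
            cases "poly b 0"; cases "poly b 1") simp_all
      then show ?thesis
        using trans ab_H additive_span.zero additive_span_add by blast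
    qed
    then show "?H = UNIV"
      by blast
  qed
qed

section \<open>Sums of two polynomials coprime to the modulus\<close>

text \<open>
  Let \<open>g\<close> be the product of the primes that divide \<open>f\<close> but not \<open>p\<close>. The summands are \<open>x p + g\<close> and
  \<open>(x+1) p + g\<close>, whose sum is \<open>p\<close>. Modulo a prime factor of \<open>f\<close>, exactly one of the terms \<open>c p\<close> and
  \<open>g\<close> of \<open>c p + g\<close> vanishes when \<open>c\<close> is \<open>x\<close> or \<open>x + 1\<close>: a prime that divides \<open>c\<close> already divides
  \<open>p\<close>, because \<open>x(x+1)\<close> does. So neither summand is divisible by a prime factor of \<open>f\<close>.
\<close>

lemma pM_multiple_sum_of_two_coprime:
  fixes f p :: "bit poly"
  assumes f: "f \<noteq> 0" and p: "pM dvd p"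
  obtains u where "coprime u f" "coprime (p + u) f"
proof -
  define P where "P = {q \<in> prime_factors f. \<not> q dvd p}"
  define g where "g = \<Prod>P"
  have g: "q dvd g \<longleftrightarrow> \<not> q dvd p" if "prime q" "q dvd f" for q
  proof -
    have "finite P"
      by (simp add: P_def)
    then have "q dvd g \<longleftrightarrow> (\<exists>r\<in>P. q dvd r)"
      unfolding g_def using that(1) by (simp add: prime_dvd_prod_iff)
    also have "\<dots> \<longleftrightarrow> q \<in> P"
      using that(1) primes_dvd_imp_eq by (auto simp: P_def)
    also have "\<dots> \<longleftrightarrow> \<not> q dvd p"
      using that f by (auto simp: P_def in_prime_factors_iff)
    finally show ?thesis .
  qed
  have cop: "coprime (c * p + g) f" if "c dvd p" for c
  proof (rule ccontr)
    assume "\<not> coprime (c * p + g) f"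
    then have "\<not> is_unit (gcd (c * p + g) f)" "gcd (c * p + g) f \<noteq> 0"
      using f by (auto simp: is_unit_gcd_iff)
    then obtain q where "prime q" "q dvd gcd (c * p + g) f"
      using prime_divisor_exists by blast
    then have q: "prime q" "q dvd c * p + g" "q dvd f"
      by auto
    show False
    proof (cases "q dvd p")
      case True
      with q(2) have "q dvd g"
        by (meson dvd_add_right_iff dvd_mult)
      with g q True show False
        by blast
    next
      case False
      with g q have "q dvd g"
        by blast
      with q(2) have "q dvd c * p"
        by (simp add: dvd_add_left_iff)
      with q(1) have "q dvd c \<or> q dvd p"
        by (rule prime_dvd_multD)
      with that False show False
        by (meson dvd_trans)
    qed
  qed
  show ?thesis
  proof
    show "coprime (pX * p + g) f"
      using p by (intro cop) (rule dvd_mult_left)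
    have "coprime ((pX + 1) * p + g) f"
      using p by (intro cop) (rule dvd_mult_right)
    then show "coprime (p + (pX * p + g)) f"
      by (simp only: algebra_simps mult_1_left mult_1_right)
  qed
qed

lemma coprime_mult_mem_span:
  assumes "coprime u f" "h \<in> additive_span (gcd_connection_set f D)"
  shows "u * h \<in> additive_span (gcd_connection_set f D)"
  using assms(2)
proof induction
  case zero
  then show ?case
    by (simp add: additive_span.zero)
next
  case (step s h)
  have "gcd (u * s) f = gcd s f"
    using assms(1) gcd_mult_left_left_cancel[of f u s] by (simp add: coprime_commute)
  with step show ?case
    by (auto simp: distrib_left gcd_connection_set_def intro!: additive_span.step)
qed

lemma pM_mult_mem_span:
  assumes "f \<noteq> 0" "pM dvd p" "h \<in> additive_span (gcd_connection_set f D)"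
  shows "p * h \<in> additive_span (gcd_connection_set f D)"
proof -
  obtain u where "coprime u f" "coprime (p + u) f"
    using pM_multiple_sum_of_two_coprime assms(1,2) by blast
  then have "(p + u) * h + u * h \<in> additive_span (gcd_connection_set f D)"
    using assms(3) by (intro additive_span_add coprime_mult_mem_span)
  then show ?thesis
    by (simp add: distrib_right add.assoc)
qed

text \<open>
  Bezout's identity for arbitrary sets: a nonzero element of least Euclidean size generates the
  ideal, so it divides \<^term>\<open>Gcd D\<close>.
\<close>

lemma Gcd_mem_ideal:
  fixes I :: "'a :: euclidean_ring_gcd set"
  assumes "I \<noteq> {}"
    and add: "\<And>a b. a \<in> I \<Longrightarrow> b \<in> I \<Longrightarrow> a + b \<in> I"
    and mult: "\<And>c a. a \<in> I \<Longrightarrow> c * a \<in> I"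
    and D: "D \<subseteq> I"
  shows "Gcd D \<in> I"
proof (cases "I \<subseteq> {0}")
  case True
  with assms(1) D have "0 \<in> I" "Gcd D = 0"
    by (auto simp: Gcd_0_iff)
  then show ?thesis
    by (simp only:)
next
  case False
  then obtain g where g: "g \<in> I" "g \<noteq> 0"
    and min: "\<And>a. a \<in> I \<Longrightarrow> a \<noteq> 0 \<Longrightarrow> euclidean_size g \<le> euclidean_size a"
    using ex_has_least_nat[of "\<lambda>a. a \<in> I \<and> a \<noteq> 0" _ euclidean_size] by blast
  have "g dvd a" if "a \<in> I" for a
  proof -
    have "a mod g = a + (- (a div g)) * g"
      by (simp add: minus_div_mult_eq_mod[symmetric])
    then have "a mod g \<in> I"
      using add[OF that mult[OF g(1)]] by (simp only:)
    then have "a mod g = 0"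
      using min[of "a mod g"] mod_size_less[OF g(2), of a] by fastforce
    then show ?thesis
      by (simp add: dvd_eq_mod_eq_0)
  qed
  then have "g dvd Gcd D"
    using D by (auto intro: Gcd_greatest)
  then show ?thesis
    using mult[OF g(1)] by (auto simp: dvd_def mult.commute)
qed

section \<open>The reduction modulo $x(x+1)$\<close>

lemma span_UNIV_iff:
  assumes f: "f \<noteq> 0" "pM dvd f" and D: "D \<noteq> {}" "\<forall>d\<in>D. d dvd f"
  shows "additive_span (gcd_connection_set f D) = UNIV \<longleftrightarrow>
    Gcd D = 1 \<and> additive_span (gcd_connection_set pM ((\<lambda>d. gcd d pM) ` D)) = UNIV"
    (is "?H = UNIV \<longleftrightarrow> _ \<and> ?K = UNIV")
proof
  assume H: "?H = UNIV"
  have "?H \<subseteq> {h. Gcd D dvd h}"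
    by (rule additive_span_minimal) (auto simp: gcd_connection_set_def dest: Gcd_dvd)
  then have "Gcd D dvd 1"
    using H by auto
  then have "Gcd D = 1"
    using normalize_bit_poly is_unit_normalize by metis
  moreover have "gcd_connection_set f D \<subseteq> gcd_connection_set pM ((\<lambda>d. gcd d pM) ` D)"
  proof
    fix s
    assume "s \<in> gcd_connection_set f D"
    moreover have "gcd s pM = gcd (gcd s f) pM"
      using f(2) by (simp only: gcd.assoc gcd_proj2_if_dvd normalize_bit_poly)
    ultimately show "s \<in> gcd_connection_set pM ((\<lambda>d. gcd d pM) ` D)"
      unfolding gcd_connection_set_def by blast
  qed
  then have "?H \<subseteq> ?K"
    using additive_span_base by (intro additive_span_subset) blast
  ultimately show "Gcd D = 1 \<and> ?K = UNIV"
    using H by blast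
next
  assume A: "Gcd D = 1 \<and> ?K = UNIV"
  have D_H: "d \<in> ?H" if "d \<in> D" for d
    using that D by (intro additive_span_base) (simp add: gcd_connection_set_def gcd_proj1_if_dvd)
  \<comment> \<open>The largest ideal whose product with \<open>x(x+1)\<close> lies in the span; the factor \<open>c\<close> makes it
    an ideal although the span is only a group.\<close>
  let ?I = "{t. \<forall>c. pM * c * t \<in> ?H}"
  have "Gcd D \<in> ?I"
  proof (rule Gcd_mem_ideal)
    have "0 \<in> ?I"
      by (simp add: additive_span.zero)
    then show "?I \<noteq> {}"
      by blast
    show "a + b \<in> ?I" if "a \<in> ?I" "b \<in> ?I" for a b
      using that additive_span_add by (simp only: mem_Collect_eq distrib_left) blast
    show "c * a \<in> ?I" if "a \<in> ?I" for c a
      using that by (simp only: mem_Collect_eq mult.assoc) (metis mult.assoc)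
    show "D \<subseteq> ?I"
      using D_H f(1) by (auto intro!: pM_mult_mem_span simp del: mult_pCons_left)
  qed
  then have pM_H: "pM * c \<in> ?H" for c
    using A by (simp only: mem_Collect_eq mult_1_right simp_thms)
  have "gcd_connection_set pM ((\<lambda>d. gcd d pM) ` D) \<subseteq> ?H"
  proof
    fix t
    assume "t \<in> gcd_connection_set pM ((\<lambda>d. gcd d pM) ` D)"
    then obtain d where d: "d \<in> D" "gcd t pM = gcd d pM"
      unfolding gcd_connection_set_def by blast
    then have "pM dvd t - d"
      by (simp only: gcd_pM_eq_iff)
    then obtain c where "t - d = pM * c"
      by (rule dvdE)
    then have "t = pM * c + d"
      by (simp only: diff_eq_eq)
    then show "t \<in> ?H"
      using additive_span_add[OF pM_H D_H[OF d(1)]] by (simp only:)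
  qed
  then have "?K \<subseteq> ?H"
    by (rule additive_span_subset)
  then show "?H = UNIV"
    using A by blast
qed

theorem theorem3p8:
  fixes f :: "bit poly" and D Dbar :: "bit poly set"
  assumes "f \<noteq> 0"
    and "pX * (pX + 1) dvd f"
    and "D \<noteq> {}"
    and "\<forall>d\<in>D. d dvd f"
    and "f \<notin> D"
    and "Dbar = (\<lambda>d. gcd d (pX * (pX + 1))) ` D"
  shows "(Digraph_Component.connected (with_proj (gcd_graph f D)) \<longleftrightarrow>
            Gcd D = 1 \<and>
            Digraph_Component.connected (with_proj (gcd_graph (pX * (pX + 1)) Dbar)))
         \<and> (Digraph_Component.connected (with_proj (gcd_graph (pX * (pX + 1)) Dbar)) \<longleftrightarrow>
            card (Dbar - {pX * (pX + 1)}) \<ge> 2)"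
proof -
  have Dbar: "Dbar \<noteq> {}" "\<forall>e\<in>Dbar. e dvd pM"
    unfolding assms(6) using assms(3) gcd_dvd2 by blast+
  show ?thesis
    unfolding connected_iff_span[OF assms(3,4)] connected_iff_span[OF Dbar] span_pM_iff[OF Dbar, symmetric]
    using span_UNIV_iff[OF assms(1-4)] unfolding assms(6) by blast
qed

end
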